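(* Let Assumptions 1, 2 and 3 (recalled in the context) hold. Let $(\mu^k)_k$ be generated by the Frank-Wolfe algorithm described in the context, and let $\gamma_k=\mathcal{J}(\mu^k)-\mathcal{J}^*$. Then, for any integer $K\ge1$, $$\gamma_K\le\frac{2C_1}{K}.$$
   Context: Setting. $N,M\ge1$ are integers; $\mathcal{X}_1,\dots,\mathcal{X}_N$ are nonempty sets and $\mathcal{X}=\prod_{i=1}^N\mathcal{X}_i$; $\mathcal{E}_1,\dots,\mathcal{E}_M$ are separable real Hilbert spaces and $\mathcal{E}=\prod_{j=1}^M\mathcal{E}_j$ with scalar product $\langle y,y'\rangle=\sum_j\langle y_j,y_j'\rangle_{\mathcal{E}_j}$. For each $i,j$ we are given maps $g_{ij}:\mathcal{X}_i\to\mathcal{E}_j$ and $f_j:\mathcal{E}_j\to\mathbb{R}$; $g_i=(g_{ij})_{j=1,\dots,M}$, $f(y)=\sum_{j=1}^M f_j(y_j)$, $G(x)=\frac1N\sum_{i=1}^Ng_i(x_i)$. Randomized problem. $\mathcal{P}_\delta(\mathcal{X}_i)$ is the set of finitely supported probability measures on $\mathcal{X}_i$, $\mathcal{P}_\delta=\prod_i\mathcal{P}_\delta(\mathcal{X}_i)$, $E_{\mu_i}[g_i]$ is the integral of $g_i$ with respect to $\mu_i$, $\mathcal{J}(\mu)=f\big(\frac1N\sum_{i=1}^NE_{\mu_i}[g_i]\big)$, and $\mathcal{J}^*=\inf_{\mu\in\mathcal{P}_\delta}\mathcal{J}(\mu)$. Assumption 1. Let $S_{ij}=g_{ij}(\mathcal{X}_i)$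 and $S_j=\frac1N\sum_{i=1}^NS_{ij}$ (Minkowski sum). For all $i,j$: (1) $S_{ij}$ has finite diameter $d_{ij}$; (2) $f_j$ is $L_j$-Lipschitz on $\mathrm{conv}(S_j)$; (3) $f_j$ is continuously differentiable on a neighborhood of $\mathrm{conv}(S_j)$ and $\nabla f_j$ is $\tilde L_j$-Lipschitz on $\mathrm{conv}(S_j)$. Assumption 2. For all $j$, $f_j$ is convex over $\mathrm{conv}(S_j)$. Assumption 3. Let $\mathcal{A}=\{\nabla f(y)\mid y\in\mathrm{conv}(G(\mathcal{X}))\}\subset\mathcal{E}$. For all $i$ and all $\lambda\in\mathcal{A}$, the problem $\inf_{x_i\in\mathcal{X}_i}\langle\lambda,g_i(x_i)\rangle$ has at least one solution; a map $\mathbb{S}_i:\mathcal{A}\to\mathcal{X}_i$ is fixed such that $\mathbb{S}_i(\lambda)$ is a solution of it for every $\lambda\in\mathcal{A}$. Constant: $C_1=\frac1N\sum_{j=1}^M\big(\tilde L_j\sum_{i=1}^Nd_{ij}^2\big)>0$. Frank-Wolfe algorithm. Let $\mu^0\in\mathcal{P}_\delta$. For $k=0,1,2,\dots$: set $y^k=\frac1N\sum_{i=1}^NE_{\mu_i^k}[g_i]$, $\lambda^k=\nabla f(y^k)$, $\bar x_i^k=\mathbb{S}_i(\lambda^k)$ for $i=1,\dots,N$, $\bar\mu^k=(\delta_{\bar x_1^k},\dots,\delta_{\bar x_N^k})$, $\omega_k=\frac{2}{k+2}$, and $\mu^{k+1}=(1-\omega_k)\mu^k+\omega_k\bar\mu^k$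 (componentwise convex combination of measures). *)

theory Defs
  imports "HOL-Analysis.Analysis" "HOL-Library.Set_Algebras" "HOL-Probability.Probability"
begin

text \<open>
  The index sets of size \<open>N\<close> and \<open>M\<close> are finite types \<open>'n\<close> and \<open>'m\<close>. The sets \<open>X i\<close> may be
  different subsets of \<open>'x\<close>. The separable Hilbert spaces \<open>E j\<close> may be different closed subspaces of
  one separable Hilbert space type \<open>'e\<close>; this is no restriction, since a finite family of separable
  Hilbert spaces embeds isometrically into its direct sum. The type \<open>'e^'m\<close> carries the scalar
  product \<open>\<Sum>j. y $ j \<bullet> y' $ j\<close>. A function on \<open>E j\<close> is represented by a function on \<open>'e\<close>, of which
  only the values on \<open>E j\<close> are used; so derivatives are taken within \<open>E j\<close>.
\<close>

text \<open>
  The gradient of \<open>F : V \<rightarrow> \<real>\<close> at \<open>y \<in> V\<close> for a closed subspace \<open>V\<close>. It is the Riesz representative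
  in \<open>V\<close> of the Frechet derivative, so it exists and is unique whenever \<open>F\<close> is differentiable
  at \<open>y\<close> within \<open>V\<close>.
\<close>

definition gradient :: "'a::real_inner set \<Rightarrow> ('a \<Rightarrow> real) \<Rightarrow> 'a \<Rightarrow> 'a" where
  "gradient V F y = (THE v. v \<in> V \<and> (F has_derivative (\<lambda>h. h \<bullet> v)) (at y within V))"

text \<open>
  Continuity of the derivative is expressed through the gradient, the Riesz map being an isometry.
\<close>

definition C1_near :: "'a::real_inner set \<Rightarrow> 'a set \<Rightarrow> ('a \<Rightarrow> real) \<Rightarrow> bool" where
  "C1_near V C F \<longleftrightarrow> (\<exists>U. openin (top_of_set V) U \<and> C \<subseteq> U \<and>
     (\<forall>y\<in>U. F differentiable (at y within V)) \<and> continuous_on U (gradient V F))"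

definition prod_space :: "('m::finite \<Rightarrow> 'e set) \<Rightarrow> ('e^'m) set" where
  "prod_space E = {y. \<forall>j. y $ j \<in> E j}"

definition fsum :: "('m::finite \<Rightarrow> 'e \<Rightarrow> real) \<Rightarrow> 'e^'m \<Rightarrow> real" where
  "fsum f y = (\<Sum>j\<in>UNIV. f j (y $ j))"

definition gvec :: "('n \<Rightarrow> 'm::finite \<Rightarrow> 'x \<Rightarrow> 'e) \<Rightarrow> 'n \<Rightarrow> 'x \<Rightarrow> 'e^'m" where
  "gvec g i x = (\<chi> j. g i j x)"

definition Gmap :: "('n::finite \<Rightarrow> 'm::finite \<Rightarrow> 'x \<Rightarrow> 'e::real_vector) \<Rightarrow> ('n \<Rightarrow> 'x) \<Rightarrow> 'e^'m" where
  "Gmap g x = (1 / real CARD('n)) *\<^sub>R (\<Sum>i\<in>UNIV. gvec g i (x i))"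

definition Pdelta :: "('n \<Rightarrow> 'x set) \<Rightarrow> ('n \<Rightarrow> 'x pmf) set" where
  "Pdelta X = {\<mu>. \<forall>i. finite (set_pmf (\<mu> i)) \<and> set_pmf (\<mu> i) \<subseteq> X i}"

text \<open>The integral of the \<open>'e^'m\<close>-valued map \<open>gvec g i\<close>, taken componentwise.\<close>

definition Eg :: "('n \<Rightarrow> 'm::finite \<Rightarrow> 'x \<Rightarrow> 'e::{banach,second_countable_topology})
    \<Rightarrow> 'n \<Rightarrow> 'x pmf \<Rightarrow> 'e^'m" where
  "Eg g i p = (\<chi> j. measure_pmf.expectation p (\<lambda>x. gvec g i x $ j))"

definition ymean :: "('n::finite \<Rightarrow> 'm::finite \<Rightarrow> 'x \<Rightarrow> 'e::{banach,second_countable_topology})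
    \<Rightarrow> ('n \<Rightarrow> 'x pmf) \<Rightarrow> 'e^'m" where
  "ymean g \<mu> = (1 / real CARD('n)) *\<^sub>R (\<Sum>i\<in>UNIV. Eg g i (\<mu> i))"

definition Jfun :: "('m::finite \<Rightarrow> 'e \<Rightarrow> real)
    \<Rightarrow> ('n::finite \<Rightarrow> 'm \<Rightarrow> 'x \<Rightarrow> 'e::{banach,second_countable_topology})
    \<Rightarrow> ('n \<Rightarrow> 'x pmf) \<Rightarrow> real" where
  "Jfun f g \<mu> = fsum f (ymean g \<mu>)"

definition Jstar :: "('n::finite \<Rightarrow> 'x set) \<Rightarrow> ('m::finite \<Rightarrow> 'e \<Rightarrow> real)
    \<Rightarrow> ('n \<Rightarrow> 'm \<Rightarrow> 'x \<Rightarrow> 'e::{banach,second_countable_topology}) \<Rightarrow> real" where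
  "Jstar X f g = (INF \<mu>\<in>Pdelta X. Jfun f g \<mu>)"

text \<open>The sum over \<open>i\<close> is the Minkowski sum of sets.\<close>

definition Sset :: "('n::finite \<Rightarrow> 'x set) \<Rightarrow> ('n \<Rightarrow> 'm \<Rightarrow> 'x \<Rightarrow> 'e::real_vector) \<Rightarrow> 'm \<Rightarrow> 'e set" where
  "Sset X g j = (\<lambda>s. (1 / real CARD('n)) *\<^sub>R s) ` (\<Sum>i\<in>UNIV. g i j ` X i)"

definition assumption1 :: "('n::finite \<Rightarrow> 'x set) \<Rightarrow> ('m::finite \<Rightarrow> 'e::real_inner set)
    \<Rightarrow> ('n \<Rightarrow> 'm \<Rightarrow> 'x \<Rightarrow> 'e) \<Rightarrow> ('m \<Rightarrow> 'e \<Rightarrow> real)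
    \<Rightarrow> ('n \<Rightarrow> 'm \<Rightarrow> real) \<Rightarrow> ('m \<Rightarrow> real) \<Rightarrow> ('m \<Rightarrow> real) \<Rightarrow> bool" where
  "assumption1 X E g f d L L' \<longleftrightarrow>
     (\<forall>i j. bounded (g i j ` X i) \<and> diameter (g i j ` X i) = d i j) \<and>
     (\<forall>j. (L j)-lipschitz_on (convex hull (Sset X g j)) (f j)) \<and>
     (\<forall>j. C1_near (E j) (convex hull (Sset X g j)) (f j) \<and>
          (L' j)-lipschitz_on (convex hull (Sset X g j)) (gradient (E j) (f j)))"

definition assumption2 :: "('n::finite \<Rightarrow> 'x set) \<Rightarrow> ('n \<Rightarrow> 'm \<Rightarrow> 'x \<Rightarrow> 'e::real_vector)
    \<Rightarrow> ('m \<Rightarrow> 'e \<Rightarrow> real) \<Rightarrow> bool" where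
  "assumption2 X g f \<longleftrightarrow> (\<forall>j. convex_on (convex hull (Sset X g j)) (f j))"

definition Aset :: "('n::finite \<Rightarrow> 'x set) \<Rightarrow> ('m::finite \<Rightarrow> 'e::real_inner set)
    \<Rightarrow> ('n \<Rightarrow> 'm \<Rightarrow> 'x \<Rightarrow> 'e) \<Rightarrow> ('m \<Rightarrow> 'e \<Rightarrow> real) \<Rightarrow> ('e^'m) set" where
  "Aset X E g f = gradient (prod_space E) (fsum f) ` (convex hull (Gmap g ` (\<Pi> i\<in>UNIV. X i)))"

definition assumption3 :: "('n::finite \<Rightarrow> 'x set) \<Rightarrow> ('m::finite \<Rightarrow> 'e::real_inner set)
    \<Rightarrow> ('n \<Rightarrow> 'm \<Rightarrow> 'x \<Rightarrow> 'e) \<Rightarrow> ('m \<Rightarrow> 'e \<Rightarrow> real) \<Rightarrow> ('n \<Rightarrow> 'e^'m \<Rightarrow> 'x) \<Rightarrow> bool" where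
  "assumption3 X E g f \<SS> \<longleftrightarrow>
     (\<forall>i. \<forall>l\<in>Aset X E g f. is_arg_min (\<lambda>x. l \<bullet> gvec g i x) (\<lambda>x. x \<in> X i) (\<SS> i l))"

definition C1_const :: "('n::finite \<Rightarrow> 'm::finite \<Rightarrow> real) \<Rightarrow> ('m \<Rightarrow> real) \<Rightarrow> real" where
  "C1_const d L' = (1 / real CARD('n)) * (\<Sum>j\<in>UNIV. L' j * (\<Sum>i\<in>UNIV. (d i j)\<^sup>2))"

text \<open>
  The convex combination of measures is stated on point masses; this determines the measure.
\<close>

definition frank_wolfe :: "('n::finite \<Rightarrow> 'x set) \<Rightarrow> ('m::finite \<Rightarrow> 'e set)
    \<Rightarrow> ('n \<Rightarrow> 'm \<Rightarrow> 'x \<Rightarrow> 'e::{real_inner,banach,second_countable_topology})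
    \<Rightarrow> ('m \<Rightarrow> 'e \<Rightarrow> real) \<Rightarrow> ('n \<Rightarrow> 'e^'m \<Rightarrow> 'x) \<Rightarrow> (nat \<Rightarrow> 'n \<Rightarrow> 'x pmf) \<Rightarrow> bool" where
  "frank_wolfe X E g f \<SS> \<mu> \<longleftrightarrow> \<mu> 0 \<in> Pdelta X \<and>
     (\<forall>k. let y = ymean g (\<mu> k);
              l = gradient (prod_space E) (fsum f) y;
              xbar = (\<lambda>i. \<SS> i l);
              \<mu>bar = (\<lambda>i. return_pmf (xbar i));
              \<omega> = 2 / (real k + 2)
          in \<forall>i x. pmf (\<mu> (Suc k) i) x = (1 - \<omega>) * pmf (\<mu> k i) x + \<omega> * pmf (\<mu>bar i) x)"

end

theory Submission
  imports Defs
begin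

text \<open>
  Every iterate enters only through its mean \<open>ymean g \<mu>\<close>, which lies in the convex hull of the image
  of \<open>Gmap g\<close> and moves along segments of it. The descent inequality for a Lipschitz gradient, with
  \<open>\<parallel>\<Delta>y\<^sub>j\<parallel>\<^sup>2 \<le> (1/N \<Sum>\<^sub>i d\<^sub>i\<^sub>j)\<^sup>2 \<le> 1/N \<Sum>\<^sub>i d\<^sub>i\<^sub>j\<^sup>2\<close> by Cauchy-Schwarz, controls the quadratic term
  by \<open>\<omega>\<^sup>2 C\<^sub>1 / 2\<close>. Linearity makes the Dirac masses at the oracle points minimize the linearization over
  all of \<open>Pdelta X\<close>, so by convexity the linear term is at most \<open>-\<omega> \<gamma>\<^sub>k\<close>. The resulting recursion
  \<open>\<gamma>\<^bsub>k+1\<^esub> \<le> (1 - \<omega>\<^sub>k) \<gamma>\<^sub>k + \<omega>\<^sub>k\<^sup>2 C\<^sub>1 / 2\<close> yields \<open>\<gamma>\<^sub>K \<le> 2 C\<^sub>1 / (K + 2)\<close> for \<open>K \<ge> 1\<close> by induction.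
\<close>

section \<open>Riesz representation and gradients within a closed subspace\<close>

text \<open>
  The representative minimizes \<open>h \<bullet> h - 2 * D h\<close> over \<open>V\<close>; a minimizing sequence is Cauchy by the
  parallelogram law.
\<close>

lemma riesz_subspace:
  fixes V :: "'a::{real_inner,banach} set"
  assumes V: "subspace V" "closed V" and D: "bounded_linear D"
  obtains v where "v \<in> V" "\<And>h. h \<in> V \<Longrightarrow> D h = h \<bullet> v"
proof -
  interpret D: bounded_linear D by (rule D)
  define Q where "Q h = h \<bullet> h - 2 * D h" for h
  define m where "m = Inf (Q ` V)"
  obtain B where B: "\<And>h. \<bar>D h\<bar> \<le> norm h * B"
    using D.bounded by auto
  \<comment> \<open>Completing the square in \<open>norm h\<close> shows that \<open>Q\<close> is
    bounded below, so its infimum \<open>m\<close> is meaningful.\<close>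
  have low: "- B\<^sup>2 \<le> Q h" for h
  proof -
    have "0 \<le> (norm h - B)\<^sup>2" by simp
    then show ?thesis
      using B[of h] by (simp add: Q_def dot_square_norm power2_diff algebra_simps abs_le_iff)
  qed
  have bdd: "bdd_below (Q ` V)"
    using low by (intro bdd_belowI[of _ "- B\<^sup>2"]) auto
  have ne: "Q ` V \<noteq> {}" using subspace_0[OF V(1)] by auto
  have m_le: "m \<le> Q h" if "h \<in> V" for h
    unfolding m_def using that bdd by (intro cInf_lower) auto
  have "\<exists>h\<in>V. Q h < m + inverse (real (Suc n))" for n
    using cInf_lessD[OF ne, of "m + inverse (real (Suc n))"] by (auto simp: m_def)
  then obtain x where x: "\<And>n. x n \<in> V" "\<And>n. Q (x n) < m + inverse (real (Suc n))"
    by metis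
  \<comment> \<open>The linear parts of \<open>Q a + Q b - 2 * Q ((1/2) *\<^sub>R (a + b))\<close>
    cancel, leaving half of the squared distance; the midpoint stays in \<open>V\<close>, so its
    value is at least \<open>m\<close>.\<close>
  have par: "(norm (a - b))\<^sup>2 \<le> 2 * (Q a - m) + 2 * (Q b - m)" if "a \<in> V" "b \<in> V" for a b
  proof -
    have "m \<le> Q ((1/2) *\<^sub>R (a + b))"
      using that V(1) by (intro m_le subspace_scale subspace_add)
    then show ?thesis
      by (simp add: Q_def power2_norm_eq_inner D.scaleR D.add algebra_simps inner_commute)
  qed
  have "Cauchy x"
  proof (rule CauchyI)
    fix e :: real assume "e > 0"
    then obtain n0 where n0: "inverse (real (Suc n0)) < e\<^sup>2 / 4"
      using reals_Archimedean[of "e\<^sup>2 / 4"] by auto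
    have *: "Q (x n) - m < e\<^sup>2 / 4" if "n \<ge> n0" for n
    proof -
      have "inverse (real (Suc n)) \<le> inverse (real (Suc n0))"
        using that by (intro le_imp_inverse_le) auto
      then show ?thesis using x(2)[of n] n0 by linarith
    qed
    have "norm (x k - x n) < e" if "k \<ge> n0" "n \<ge> n0" for k n
    proof -
      have "(norm (x k - x n))\<^sup>2 < e\<^sup>2"
        using par[OF x(1) x(1), of k n] *[OF that(1)] *[OF that(2)] by (simp add: field_simps)
      then show ?thesis using \<open>e > 0\<close> by (meson less_imp_le power_less_imp_less_base)
    qed
    then show "\<exists>M. \<forall>k\<ge>M. \<forall>n\<ge>M. norm (x k - x n) < e" by blast
  qed
  then obtain v where lim: "x \<longlonglongrightarrow> v"
    using Cauchy_convergent convergent_def by blast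
  have vV: "v \<in> V" using V(2) x(1) lim closed_sequentially by blast
  have "(\<lambda>n. Q (x n)) \<longlonglongrightarrow> Q v"
    unfolding Q_def by (intro tendsto_intros lim D.tendsto)
  moreover have "(\<lambda>n. m + inverse (real (Suc n))) \<longlonglongrightarrow> m + 0"
    by (intro tendsto_intros LIMSEQ_inverse_real_of_nat)
  ultimately have "Q v \<le> m + 0"
    by (rule LIMSEQ_le) (use x(2) less_imp_le in blast)
  then have vmin: "Q v \<le> Q h" if "h \<in> V" for h using m_le[OF that] by simp
  have "D h = h \<bullet> v" if "h \<in> V" for h
  proof (rule ccontr)
    define c where "c = h \<bullet> v - D h"
    \<comment> \<open>The step length makes the quadratic term at most \<open>c\<^sup>2 * s\<close>,
      too small to offset the linear gain \<open>2 * c\<^sup>2 * s\<close>. The summand 1 in the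
      denominator also covers \<open>h = 0\<close>.\<close>
    define s where "s = 1 / (h \<bullet> h + 1)"
    assume "D h \<noteq> h \<bullet> v"
    then have c: "c \<noteq> 0" by (simp add: c_def)
    have s: "s > 0" by (simp add: s_def add_nonneg_pos)
    have s1: "s * (h \<bullet> h) = 1 - s" by (simp add: s_def field_simps add_nonneg_pos add_nonneg_eq_0_iff)
    have "Q v \<le> Q (v + (- c * s) *\<^sub>R h)"
      using that vV V(1) by (intro vmin subspace_add subspace_scale)
    then have "0 \<le> - 2 * c * s * c + (c * s)\<^sup>2 * (h \<bullet> h)"
      by (simp add: Q_def c_def D.add D.diff D.scaleR algebra_simps inner_commute power2_eq_square)
    also have "\<dots> = c\<^sup>2 * s * (s * (h \<bullet> h) - 2)"
      by (simp add: power2_eq_square algebra_simps)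
    also have "\<dots> < 0"
      using c s unfolding s1 by (intro mult_pos_neg) auto
    finally show False by simp
  qed
  with vV show thesis by (rule that)
qed

text \<open>A line through a point of \<open>V\<close> with direction in \<open>V\<close> never
  leaves \<open>V\<close>, so a derivative relative to \<open>V\<close> becomes an ordinary
  two-sided derivative in one real variable.\<close>

lemma line_derivative:
  assumes V: "subspace V" "y \<in> V" "u \<in> V"
    and F: "(F has_derivative (\<lambda>h. h \<bullet> v)) (at (y + t *\<^sub>R u) within V)"
  shows "((\<lambda>s. F (y + s *\<^sub>R u)) has_real_derivative u \<bullet> v) (at t)"
proof -
  have "(\<lambda>s. y + s *\<^sub>R u) ` UNIV \<subseteq> V"
    using V by (auto intro: subspace_add subspace_scale)
  then have "(F has_derivative (\<lambda>h. h \<bullet> v)) (at (y + t *\<^sub>R u) within (\<lambda>s. y + s *\<^sub>R u) ` UNIV)"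
    by (rule has_derivative_subset[OF F])
  then have "((\<lambda>s. F (y + s *\<^sub>R u)) has_derivative (\<lambda>s. (s *\<^sub>R u) \<bullet> v)) (at t)"
    by (rule has_derivative_in_compose[rotated]) (auto intro!: derivative_eq_intros)
  then show ?thesis
    unfolding has_field_derivative_def by (rule has_derivative_eq_rhs) (simp add: mult.commute fun_eq_iff)
qed

text \<open>The difference of two candidates is itself a direction in \<open>V\<close>; comparing
  the derivatives along it shows that its norm is zero. This resolves the definite description in
  \<open>gradient\<close>.\<close>

lemma gradient_eqI:
  assumes V: "subspace V" "y \<in> V" "v \<in> V"
    and F: "(F has_derivative (\<lambda>h. h \<bullet> v)) (at y within V)"
  shows "gradient V F y = v"
  unfolding gradient_def
proof (rule the_equality)
  show "v \<in> V \<and> (F has_derivative (\<lambda>h. h \<bullet> v)) (at y within V)"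
    using assms by blast
  fix w assume w: "w \<in> V \<and> (F has_derivative (\<lambda>h. h \<bullet> w)) (at y within V)"
  then have "w - v \<in> V" using V by (auto intro: subspace_diff)
  then have "((\<lambda>s. F (y + s *\<^sub>R (w - v))) has_real_derivative (w - v) \<bullet> v) (at 0)"
    and "((\<lambda>s. F (y + s *\<^sub>R (w - v))) has_real_derivative (w - v) \<bullet> w) (at 0)"
    using V F w by (auto intro!: line_derivative)
  then have "(w - v) \<bullet> v = (w - v) \<bullet> w" by (rule DERIV_unique)
  then have "(w - v) \<bullet> (w - v) = 0" by (simp add: inner_diff_right)
  then show "w = v" by simp
qed

text \<open>A Frechet derivative within \<open>V\<close> is a linear map on the whole type.
  Replacing it by its Riesz representative changes it at most off \<open>V\<close>, and the limit
  only tests increments \<open>z - y\<close> in \<open>V\<close>.\<close>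

lemma gradient_props:
  fixes V :: "'a::{real_inner,banach} set"
  assumes V: "subspace V" "closed V" "y \<in> V" and F: "F differentiable (at y within V)"
  shows gradient_in: "gradient V F y \<in> V"
    and has_derivative_gradient: "(F has_derivative (\<lambda>h. h \<bullet> gradient V F y)) (at y within V)"
proof -
  from F obtain D where D: "(F has_derivative D) (at y within V)"
    by (auto simp: differentiable_def)
  obtain v where v: "v \<in> V" "\<And>h. h \<in> V \<Longrightarrow> D h = h \<bullet> v"
    using riesz_subspace[OF V(1,2) has_derivative_bounded_linear[OF D]] by blast
  have "D (z - y) = (z - y) \<bullet> v" if "z \<in> V" for z
    using that V by (intro v subspace_diff)
  then have "(F has_derivative (\<lambda>h. h \<bullet> v)) (at y within V)"
    using D unfolding has_derivative_within
    by (auto intro!: bounded_linear_inner_left elim!: Lim_transform_within[where d=1])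
  with v(1) V show "gradient V F y \<in> V"
    "(F has_derivative (\<lambda>h. h \<bullet> gradient V F y)) (at y within V)"
    by (simp_all add: gradient_eqI)
qed

text \<open>The objective is separable, so its derivative is a sum over blocks. This lets the later
  estimates work one \<open>j\<close> at a time.\<close>

lemma gradient_fsum:
  fixes E :: "'m::finite \<Rightarrow> 'e::{real_inner,banach} set"
  assumes E: "\<And>j. subspace (E j)" "\<And>j. closed (E j)" "\<And>j. y $ j \<in> E j"
    and f: "\<And>j. f j differentiable (at (y $ j) within E j)"
  shows "gradient (prod_space E) (fsum f) y = (\<chi> j. gradient (E j) (f j) (y $ j))"
proof (rule gradient_eqI)
  show "subspace (prod_space E)"
    using E(1) by (auto simp: subspace_def prod_space_def)
  show "y \<in> prod_space E" using E(3) by (simp add: prod_space_def)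
  show "(\<chi> j. gradient (E j) (f j) (y $ j)) \<in> prod_space E"
    using E f by (simp add: prod_space_def gradient_in)
  have "((\<lambda>z. f j (z $ j)) has_derivative (\<lambda>h. h $ j \<bullet> gradient (E j) (f j) (y $ j)))
      (at y within prod_space E)" for j
  proof (rule has_derivative_in_compose[where g = "f j" and f = "\<lambda>z. z $ j"])
    show "((\<lambda>z. z $ j) has_derivative (\<lambda>h. h $ j)) (at y within prod_space E)"
      by (rule bounded_linear_imp_has_derivative) auto
    show "(f j has_derivative (\<lambda>h. h \<bullet> gradient (E j) (f j) (y $ j)))
        (at (y $ j) within (\<lambda>z. z $ j) ` prod_space E)"
      using has_derivative_gradient[OF E f]
      by (rule has_derivative_subset) (auto simp: prod_space_def)
  qed
  then show "(fsum f has_derivative (\<lambda>h. h \<bullet> (\<chi> j. gradient (E j) (f j) (y $ j))))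
      (at y within prod_space E)"
    unfolding fsum_def inner_vec_def by (simp add: has_derivative_sum)
qed

section \<open>Upper and lower estimates along a segment\<close>

text \<open>\<open>\<psi>\<close> is \<open>F\<close> minus its quadratic model along the segment.
  The Lipschitz bound on the gradient makes its derivative nonpositive, hence
  \<open>\<psi> w \<le> \<psi> 0\<close>.\<close>

lemma descent_on_segment:
  fixes V :: "'a::{real_inner,banach} set"
  assumes V: "subspace V" "closed V" and C: "convex C" "C \<subseteq> V"
    and F: "\<And>z. z \<in> C \<Longrightarrow> F differentiable (at z within V)"
    and Lip: "B-lipschitz_on C (gradient V F)"
    and y: "y \<in> C" "z \<in> C" and w: "0 \<le> w" "w \<le> 1"
  shows "F ((1 - w) *\<^sub>R y + w *\<^sub>R z) \<le> F y + w * ((z - y) \<bullet> gradient V F y) + w\<^sup>2 / 2 * B * (norm (z - y))\<^sup>2"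
proof -
  define u where "u = z - y"
  define \<psi> where "\<psi> t = F (y + t *\<^sub>R u) - t * (u \<bullet> gradient V F y) - t\<^sup>2 / 2 * B * (norm u)\<^sup>2" for t
  have seg: "y + t *\<^sub>R u \<in> C" if "0 \<le> t" "t \<le> 1" for t
    using convexD_alt[OF C(1) y that] by (simp add: u_def algebra_simps)
  have "\<exists>D. (\<psi> has_real_derivative D) (at t) \<and> D \<le> 0" if t: "0 \<le> t" "t \<le> w" for t
  proof -
    let ?p = "y + t *\<^sub>R u"
    have p: "?p \<in> C" using t w by (intro seg) auto
    \<comment> \<open>The derivative is two-sided even at the ends of the segment: the line may
      leave \<open>C\<close> but not \<open>V\<close>.\<close>
    have "((\<lambda>s. F (y + s *\<^sub>R u)) has_real_derivative u \<bullet> gradient V F ?p) (at t)"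
      using y C(2) p V F by (intro line_derivative[OF V(1)] has_derivative_gradient)
        (auto simp: u_def intro: subspace_diff)
    then have "(\<psi> has_real_derivative (u \<bullet> gradient V F ?p - u \<bullet> gradient V F y - t * B * (norm u)\<^sup>2)) (at t)"
      unfolding \<psi>_def by (auto intro!: derivative_eq_intros)
    moreover have "u \<bullet> gradient V F ?p - u \<bullet> gradient V F y \<le> norm u * norm (gradient V F ?p - gradient V F y)"
      unfolding inner_diff_right[symmetric] by (rule norm_cauchy_schwarz)
    moreover have "\<dots> \<le> norm u * (B * (t * norm u))"
      using lipschitz_onD[OF Lip p y(1)] t by (intro mult_left_mono) (auto simp: dist_norm)
    ultimately show ?thesis
      by (intro exI conjI) (auto simp: power2_eq_square algebra_simps)
  qed
  then have "\<psi> w \<le> \<psi> 0" by (rule DERIV_nonpos_imp_nonincreasing[OF w(1)])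
  moreover have "y + w *\<^sub>R u = (1 - w) *\<^sub>R y + w *\<^sub>R z"
    by (simp add: u_def algebra_simps)
  ultimately show ?thesis by (simp add: \<psi>_def u_def)
qed

text \<open>Convexity bounds the difference quotients along the segment by \<open>F z - F y\<close>;
  their limit from the right is the directional derivative.\<close>

lemma convex_above_gradient:
  fixes V :: "'a::{real_inner,banach} set"
  assumes V: "subspace V" "closed V" and C: "convex_on C F" "C \<subseteq> V"
    and F: "F differentiable (at y within V)" and y: "y \<in> C" "z \<in> C"
  shows "F y + (z - y) \<bullet> gradient V F y \<le> F z"
proof -
  define \<phi> where "\<phi> t = F (y + t *\<^sub>R (z - y))" for t
  have "(\<phi> has_real_derivative (z - y) \<bullet> gradient V F y) (at 0)"
    unfolding \<phi>_def using y C(2) V F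
    by (intro line_derivative[OF V(1)]) (auto intro!: has_derivative_gradient intro: subspace_diff)
  then have "((\<lambda>t. (\<phi> t - \<phi> 0) / (t - 0)) \<longlongrightarrow> (z - y) \<bullet> gradient V F y) (at_right 0)"
    unfolding has_field_derivative_iff by (rule tendsto_mono[OF at_le[OF subset_UNIV]])
  moreover have "eventually (\<lambda>t. (\<phi> t - \<phi> 0) / (t - 0) \<le> F z - F y) (at_right 0)"
    unfolding eventually_at_right_field
  proof (intro exI[of _ 1] conjI allI impI)
    fix t :: real assume t: "t > 0" "t < 1"
    have "\<phi> t \<le> (1 - t) * F y + t * F z"
      using convex_onD[OF C(1), of t y z] t y by (simp add: \<phi>_def algebra_simps)
    then have "\<phi> t - \<phi> 0 \<le> t * (F z - F y)"
      by (simp add: \<phi>_def algebra_simps)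
    then show "(\<phi> t - \<phi> 0) / (t - 0) \<le> F z - F y"
      using t by (simp add: field_simps)
  qed simp
  ultimately have "(z - y) \<bullet> gradient V F y \<le> F z - F y"
    by (rule tendsto_upperbound) simp
  then show ?thesis by simp
qed

section \<open>Finitely supported measures, their means and convex hulls\<close>

text \<open>Allowing any finite \<open>A\<close> containing the support gives two measures and their
  mixture a common index set.\<close>

lemma Eg_eq_sum:
  assumes "finite A" "set_pmf p \<subseteq> A"
  shows "Eg g i p = (\<Sum>x\<in>A. pmf p x *\<^sub>R gvec g i x)"
proof (rule vec_eq_iff[THEN iffD2], rule allI)
  fix j
  show "Eg g i p $ j = (\<Sum>x\<in>A. pmf p x *\<^sub>R gvec g i x) $ j"
    using assms unfolding Eg_def by (subst vec_lambda_beta, subst integral_measure_pmf[of A]) auto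
qed

lemma Eg_in_convex_hull:
  assumes "finite (set_pmf p)" "set_pmf p \<subseteq> S"
  shows "Eg g i p \<in> convex hull (gvec g i ` S)"
  unfolding Eg_eq_sum[OF assms(1) order_refl]
  using assms by (intro convex_sum) (auto simp: sum_pmf_eq_1 intro!: hull_inc)

lemma sum_image_eq_Pi_image:
  "(\<Sum>i\<in>UNIV. h i ` X i) = (\<lambda>x. \<Sum>i\<in>UNIV. h i (x i)) ` Pi UNIV X"
  for h :: "'n::finite \<Rightarrow> 'x \<Rightarrow> 'e::real_vector"
proof (intro equalityI subsetI)
  fix y assume "y \<in> (\<Sum>i\<in>UNIV. h i ` X i)"
  then obtain s where s: "y = sum s UNIV" "\<forall>i. s i \<in> h i ` X i"
    by (auto simp: set_sum_alt)
  then have "\<forall>i. \<exists>x. x \<in> X i \<and> s i = h i x" by blast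
  then obtain x where "\<And>i. x i \<in> X i \<and> s i = h i (x i)" by metis
  then show "y \<in> (\<lambda>x. \<Sum>i\<in>UNIV. h i (x i)) ` Pi UNIV X"
    using s(1) by (intro image_eqI[of _ _ x]) auto
qed (auto simp: set_sum_alt)

text \<open>Writing the image as a scaled Minkowski sum makes it possible to move the convex hull
  inside.\<close>

lemma Gmap_image:
  "Gmap g ` Pi UNIV X = (\<lambda>s. (1 / real CARD('n)) *\<^sub>R s) ` (\<Sum>i\<in>UNIV. gvec g i ` X i)"
  for X :: "'n::finite \<Rightarrow> 'x set"
  by (simp add: sum_image_eq_Pi_image image_image Gmap_def)

text \<open>Convex hulls commute with Minkowski sums and scaling, so averaging each
  \<open>g i\<close> independently stays in the hull. Gradients at such means therefore belong to
  \<open>Aset\<close>, where the oracle is specified.\<close>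

lemma ymean_in_convex_hull:
  fixes X :: "'n::finite \<Rightarrow> 'x set"
  assumes "\<mu> \<in> Pdelta X"
  shows "ymean g \<mu> \<in> convex hull (Gmap g ` Pi UNIV X)"
proof -
  have "(\<Sum>i\<in>UNIV. Eg g i (\<mu> i)) \<in> (\<Sum>i\<in>UNIV. convex hull (gvec g i ` X i))"
    using assms by (auto simp: set_sum_alt Pdelta_def intro!: Eg_in_convex_hull)
  then show ?thesis
    by (simp add: ymean_def Gmap_image convex_hull_scaling convex_hull_set_sum)
qed

text \<open>Bridges the blockwise hypotheses, stated on the hulls of the \<open>Sset X g j\<close>,
  and the means, which live in the hull of the image of \<open>Gmap g\<close>.\<close>

lemma Sset_eq_component:
  "Sset X g j = (\<lambda>y. y $ j) ` Gmap g ` Pi UNIV X"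
  by (simp add: Sset_def sum_image_eq_Pi_image image_image Gmap_def gvec_def)

lemma nth_in_convex_hull_Sset:
  fixes g :: "'n::finite \<Rightarrow> 'm::finite \<Rightarrow> 'x \<Rightarrow> 'e::real_normed_vector"
  assumes "y \<in> convex hull (Gmap g ` Pi UNIV X)"
  shows "y $ j \<in> convex hull (Sset X g j)"
  using assms unfolding Sset_eq_component
  by (simp add: convex_hull_linear_image[OF bounded_linear.linear[OF bounded_linear_vec_nth], symmetric])

text \<open>Balls are convex, so the bound extends to the hull one argument at a time: first with
  the centre in \<open>S\<close>, then with the centre \<open>a\<close> in the hull.\<close>

lemma dist_convex_hull_le_diameter:
  fixes S :: "'a::real_normed_vector set"
  assumes S: "bounded S" and a: "a \<in> convex hull S" and b: "b \<in> convex hull S"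
  shows "dist a b \<le> diameter S"
proof -
  have *: "convex hull S \<subseteq> cball x (diameter S)" if "x \<in> S" for x
    using that S by (intro hull_minimal) (auto intro: diameter_bounded_bound)
  have "convex hull S \<subseteq> cball a (diameter S)"
    using a * by (intro hull_minimal) (force simp: dist_commute)+
  with b show ?thesis by auto
qed

lemma pmf_mixture:
  fixes X :: "'n::finite \<Rightarrow> 'x set"
  assumes \<mu>: "\<mu> \<in> Pdelta X" and \<nu>: "\<nu> \<in> Pdelta X"
    and mix: "\<And>i x. pmf (\<rho> i) x = (1 - w) * pmf (\<mu> i) x + w * pmf (\<nu> i) x"
  shows mixture_in_Pdelta: "\<rho> \<in> Pdelta X"
    and ymean_mixture: "ymean g \<rho> = (1 - w) *\<^sub>R ymean g \<mu> + w *\<^sub>R ymean g \<nu>"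
proof -
  define A where "A i = set_pmf (\<mu> i) \<union> set_pmf (\<nu> i)" for i
  have A: "finite (A i)" "A i \<subseteq> X i" "set_pmf (\<mu> i) \<subseteq> A i" "set_pmf (\<nu> i) \<subseteq> A i" for i
    using \<mu> \<nu> by (auto simp: A_def Pdelta_def)
  \<comment> \<open>A point outside both supports has mass zero in the mixture as well.\<close>
  have \<rho>: "set_pmf (\<rho> i) \<subseteq> A i" for i
    by (auto simp: A_def set_pmf_iff mix)
  show "\<rho> \<in> Pdelta X"
    unfolding Pdelta_def using finite_subset[OF \<rho> A(1)] order_trans[OF \<rho> A(2)] by simp
  have "Eg g i (\<rho> i) = (1 - w) *\<^sub>R Eg g i (\<mu> i) + w *\<^sub>R Eg g i (\<nu> i)" for i
    
    by (simp add: Eg_eq_sum[OF A(1) \<rho>] Eg_eq_sum[OF A(1,3)] Eg_eq_sum[OF A(1,4)] mix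
        scaleR_add_left sum.distrib scaleR_sum_right)
  then show "ymean g \<rho> = (1 - w) *\<^sub>R ymean g \<mu> + w *\<^sub>R ymean g \<nu>"
    by (simp add: ymean_def sum.distrib scaleR_sum_right scaleR_add_right mult.commute)
qed

section \<open>One Frank-Wolfe step for the given problem data\<close>

locale frank_wolfe_setting =
  fixes X :: "'n::finite \<Rightarrow> 'x set"
    and E :: "'m::finite \<Rightarrow> 'e::{real_inner,banach,second_countable_topology} set"
    and g :: "'n \<Rightarrow> 'm \<Rightarrow> 'x \<Rightarrow> 'e"
    and f :: "'m \<Rightarrow> 'e \<Rightarrow> real"
    and d :: "'n \<Rightarrow> 'm \<Rightarrow> real"
    and L L' :: "'m \<Rightarrow> real"
    and \<SS> :: "'n \<Rightarrow> 'e^'m \<Rightarrow> 'x"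
  assumes E: "\<And>j. subspace (E j)" "\<And>j. closed (E j)"
    and g: "\<And>i j. g i j \<in> X i \<rightarrow> E j"
    and A1: "assumption1 X E g f d L L'"
    and A2: "assumption2 X g f"
    and A3: "assumption3 X E g f \<SS>"
begin

abbreviation "grad \<equiv> gradient (prod_space E) (fsum f)"
abbreviation "H \<equiv> convex hull (Gmap g ` Pi UNIV X)"

text \<open>Places the region where \<open>f j\<close> is controlled inside the subspace relative to
  which its gradient is taken.\<close>

lemma hull_Sset_subset: "convex hull (Sset X g j) \<subseteq> E j"
proof (rule hull_minimal)
  show "Sset X g j \<subseteq> E j"
    unfolding Sset_eq_component
    by (auto simp: Gmap_def gvec_def intro!: subspace_scale[OF E(1)] subspace_sum[OF E(1)] funcset_mem[OF g])
qed (simp add: E subspace_imp_convex)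

lemma differentiable_component:
  "z \<in> convex hull (Sset X g j) \<Longrightarrow> f j differentiable (at z within E j)"
  using A1 unfolding assumption1_def C1_near_def by blast

lemma grad_nth:
  assumes "y \<in> H"
  shows "grad y $ j = gradient (E j) (f j) (y $ j)"
proof -
  have "y $ j \<in> convex hull (Sset X g j)" for j
    using assms by (rule nth_in_convex_hull_Sset)
  then show ?thesis
    using hull_Sset_subset by (subst gradient_fsum[OF E]) (auto intro: differentiable_component)
qed

lemma fsum_above_gradient:
  assumes y: "y \<in> H" and z: "z \<in> H"
  shows "fsum f y + (z - y) \<bullet> grad y \<le> fsum f z"
proof -
  have "f j (y $ j) + (z $ j - y $ j) \<bullet> gradient (E j) (f j) (y $ j) \<le> f j (z $ j)" for j
    using A2 hull_Sset_subset y z unfolding assumption2_def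
    by (intro convex_above_gradient[OF E, where C = "convex hull (Sset X g j)"])
      (auto intro: differentiable_component nth_in_convex_hull_Sset)
  then show ?thesis
    by (simp add: fsum_def inner_vec_def grad_nth[OF y] sum.distrib[symmetric] sum_mono)
qed

lemma fsum_descent:
  assumes y: "y \<in> H" and z: "z \<in> H" and w: "0 \<le> w" "w \<le> 1"
  shows "fsum f ((1 - w) *\<^sub>R y + w *\<^sub>R z)
    \<le> fsum f y + w * ((z - y) \<bullet> grad y) + w\<^sup>2 / 2 * (\<Sum>j\<in>UNIV. L' j * (norm (z $ j - y $ j))\<^sup>2)"
proof -
  have "f j ((1 - w) *\<^sub>R y $ j + w *\<^sub>R z $ j)
      \<le> f j (y $ j) + w * ((z $ j - y $ j) \<bullet> gradient (E j) (f j) (y $ j))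
        + w\<^sup>2 / 2 * L' j * (norm (z $ j - y $ j))\<^sup>2" for j
    using A1 hull_Sset_subset y z w unfolding assumption1_def
    by (intro descent_on_segment[OF E, where C = "convex hull (Sset X g j)"])
      (auto intro: differentiable_component nth_in_convex_hull_Sset)
  then show ?thesis
    by (simp add: fsum_def inner_vec_def grad_nth[OF y] sum.distrib[symmetric] sum_distrib_left
        mult.assoc sum_mono)
qed

lemma sum_norm_ymean_diff_le:
  assumes \<mu>: "\<mu> \<in> Pdelta X" and \<nu>: "\<nu> \<in> Pdelta X"
  shows "(\<Sum>j\<in>UNIV. L' j * (norm (ymean g \<nu> $ j - ymean g \<mu> $ j))\<^sup>2) \<le> C1_const d L'"
proof -
  let ?N = "real CARD('n)"
  have "L' j * (norm (ymean g \<nu> $ j - ymean g \<mu> $ j))\<^sup>2 \<le> L' j * ((1 / ?N) * (\<Sum>i\<in>UNIV. (d i j)\<^sup>2))" for j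
  proof (rule mult_left_mono)
    show "0 \<le> L' j" using A1 by (auto simp: assumption1_def lipschitz_on_def)
    \<comment> \<open>Expectations lie in the hull of the values of \<open>g i j\<close>, whose
      points are no further apart than the diameter \<open>d i j\<close>.\<close>
    have hull: "Eg g i (\<rho> i) $ j \<in> convex hull (g i j ` X i)" if "\<rho> \<in> Pdelta X" for i \<rho>
    proof -
      have "linear (\<lambda>y::'e^'m. y $ j)" by (rule bounded_linear.linear) auto
      then have "(\<lambda>y. y $ j) ` (convex hull (gvec g i ` X i)) = convex hull (g i j ` X i)"
        by (simp add: convex_hull_linear_image image_image gvec_def)
      moreover have "Eg g i (\<rho> i) \<in> convex hull (gvec g i ` X i)"
        using that by (auto simp: Pdelta_def intro: Eg_in_convex_hull)
      ultimately show ?thesis by blast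
    qed
    have d: "norm (Eg g i (\<nu> i) $ j - Eg g i (\<mu> i) $ j) \<le> d i j" for i
      using A1 dist_convex_hull_le_diameter[OF _ hull[OF \<nu>] hull[OF \<mu>], of i]
      by (auto simp: assumption1_def dist_norm)
    have "ymean g \<nu> $ j - ymean g \<mu> $ j
        = (1 / ?N) *\<^sub>R (\<Sum>i\<in>UNIV. Eg g i (\<nu> i) $ j - Eg g i (\<mu> i) $ j)"
      by (simp add: ymean_def sum_subtractf scaleR_diff_right)
    also have "norm \<dots> \<le> (1 / ?N) * (\<Sum>i\<in>UNIV. d i j)"
      using d by (auto intro!: divide_right_mono sum_norm_le)
    finally have "(norm (ymean g \<nu> $ j - ymean g \<mu> $ j))\<^sup>2 \<le> ((1 / ?N) * (\<Sum>i\<in>UNIV. d i j))\<^sup>2"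
      by (rule power_mono) simp
    also have "\<dots> = (1 / ?N)\<^sup>2 * (\<Sum>i\<in>UNIV. d i j)\<^sup>2"
      by (rule power_mult_distrib)
    \<comment> \<open>Cauchy-Schwarz costs a factor \<open>?N\<close>, which cancels one of the two
      factors \<open>1 / ?N\<close>.\<close>
    also have "\<dots> \<le> (1 / ?N)\<^sup>2 * ((\<Sum>i\<in>UNIV. (d i j)\<^sup>2) * ?N)"
      by (intro mult_left_mono sum_squared_le_sum_of_squares) auto
    also have "\<dots> = (1 / ?N) * (\<Sum>i\<in>UNIV. (d i j)\<^sup>2)"
      by (simp add: power2_eq_square)
    finally show "(norm (ymean g \<nu> $ j - ymean g \<mu> $ j))\<^sup>2 \<le> (1 / ?N) * (\<Sum>i\<in>UNIV. (d i j)\<^sup>2)" .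
  qed
  then have "(\<Sum>j\<in>UNIV. L' j * (norm (ymean g \<nu> $ j - ymean g \<mu> $ j))\<^sup>2)
      \<le> (\<Sum>j\<in>UNIV. L' j * ((1 / ?N) * (\<Sum>i\<in>UNIV. (d i j)\<^sup>2)))"
    by (rule sum_mono)
  also have "\<dots> = C1_const d L'"
    by (simp add: C1_const_def sum_distrib_left mult.left_commute)
  finally show ?thesis .
qed

lemma oracle_in_Pdelta:
  assumes "l \<in> Aset X E g f"
  shows "(\<lambda>i. return_pmf (\<SS> i l)) \<in> Pdelta X"
  using A3 assms by (auto simp: Pdelta_def assumption3_def is_arg_min_def)

text \<open>For each \<open>i\<close>, the half-space above the oracle value contains all values of
  \<open>gvec g i\<close> on \<open>X i\<close>, hence their hull and every expectation; averaging
  over \<open>i\<close> preserves the inequality.\<close>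

lemma oracle_minimizes:
  assumes l: "l \<in> Aset X E g f" and \<mu>: "\<mu> \<in> Pdelta X"
  shows "l \<bullet> ymean g (\<lambda>i. return_pmf (\<SS> i l)) \<le> l \<bullet> ymean g \<mu>"
proof -
  have "l \<bullet> Eg g i (return_pmf (\<SS> i l)) \<le> l \<bullet> Eg g i (\<mu> i)" for i
  proof -
    have "convex hull (gvec g i ` X i) \<subseteq> {z. l \<bullet> z \<ge> l \<bullet> gvec g i (\<SS> i l)}"
      using A3 l by (intro hull_minimal convex_halfspace_ge)
        (auto simp: assumption3_def is_arg_min_linorder)
    moreover have "Eg g i (\<mu> i) \<in> convex hull (gvec g i ` X i)"
      using \<mu> by (auto simp: Pdelta_def intro: Eg_in_convex_hull)
    moreover have "Eg g i (return_pmf (\<SS> i l)) = gvec g i (\<SS> i l)"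
      by (subst Eg_eq_sum[of "{\<SS> i l}"]) auto
    ultimately show ?thesis by auto
  qed
  then show ?thesis
    by (auto simp: ymean_def inner_sum_right intro!: divide_right_mono sum_mono)
qed

lemma frank_wolfe_gap_step:
  assumes \<mu>: "\<mu> \<in> Pdelta X" and w: "0 \<le> w" "w \<le> 1"
    and mix: "\<And>i x. pmf (\<rho> i) x
      = (1 - w) * pmf (\<mu> i) x + w * pmf (return_pmf (\<SS> i (grad (ymean g \<mu>)))) x"
  shows "\<rho> \<in> Pdelta X"
    and "Jfun f g \<rho> - Jstar X f g
      \<le> (1 - w) * (Jfun f g \<mu> - Jstar X f g) + w\<^sup>2 / 2 * C1_const d L'"
proof -
  define y where "y = ymean g \<mu>"
  define \<nu> where "\<nu> = (\<lambda>i. return_pmf (\<SS> i (grad y)))"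
  have y: "y \<in> H" unfolding y_def using \<mu> by (rule ymean_in_convex_hull)
  then have l: "grad y \<in> Aset X E g f" by (auto simp: Aset_def)
  have \<nu>: "\<nu> \<in> Pdelta X" unfolding \<nu>_def using l by (rule oracle_in_Pdelta)
  have mix': "pmf (\<rho> i) x = (1 - w) * pmf (\<mu> i) x + w * pmf (\<nu> i) x" for i x
    using mix by (simp add: \<nu>_def y_def)
  show "\<rho> \<in> Pdelta X" using \<mu> \<nu> mix' by (rule mixture_in_Pdelta)
  \<comment> \<open>The linearization at \<open>y\<close> lies below the objective, and
    \<open>\<nu>\<close> minimizes it over \<open>Pdelta X\<close>; its value at
    \<open>\<nu>\<close> thus bounds every competitor from below, and so the infimum.\<close>
  have "Jfun f g \<mu> + (ymean g \<nu> - y) \<bullet> grad y \<le> Jstar X f g"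
    unfolding Jstar_def
  proof (rule cINF_greatest)
    fix \<theta> assume \<theta>: "\<theta> \<in> Pdelta X"
    have "fsum f y + (ymean g \<theta> - y) \<bullet> grad y \<le> fsum f (ymean g \<theta>)"
      using y \<theta> by (intro fsum_above_gradient ymean_in_convex_hull)
    then show "Jfun f g \<mu> + (ymean g \<nu> - y) \<bullet> grad y \<le> Jfun f g \<theta>"
      using oracle_minimizes[OF l \<theta>, unfolded inner_commute[of "grad y"]]
      by (simp add: Jfun_def y_def[symmetric] \<nu>_def inner_diff_left)
  qed (use \<mu> in auto)
  then have gap: "w * ((ymean g \<nu> - y) \<bullet> grad y) \<le> w * (Jstar X f g - Jfun f g \<mu>)"
    using w(1) by (intro mult_left_mono) auto
  have "Jfun f g \<rho> = fsum f ((1 - w) *\<^sub>R y + w *\<^sub>R ymean g \<nu>)"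
    by (simp add: Jfun_def y_def ymean_mixture[OF \<mu> \<nu> mix'])
  also have "\<dots> \<le> fsum f y + w * ((ymean g \<nu> - y) \<bullet> grad y)
      + w\<^sup>2 / 2 * (\<Sum>j\<in>UNIV. L' j * (norm (ymean g \<nu> $ j - y $ j))\<^sup>2)"
    using y \<nu> w by (intro fsum_descent ymean_in_convex_hull)
  also have "w\<^sup>2 / 2 * (\<Sum>j\<in>UNIV. L' j * (norm (ymean g \<nu> $ j - y $ j))\<^sup>2) \<le> w\<^sup>2 / 2 * C1_const d L'"
    unfolding y_def by (intro mult_left_mono sum_norm_ymean_diff_le \<mu> \<nu>) auto
  finally have "Jfun f g \<rho> \<le> Jfun f g \<mu> + w * ((ymean g \<nu> - y) \<bullet> grad y) + w\<^sup>2 / 2 * C1_const d L'"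
    by (simp add: Jfun_def y_def)
  with gap show "Jfun f g \<rho> - Jstar X f g
      \<le> (1 - w) * (Jfun f g \<mu> - Jstar X f g) + w\<^sup>2 / 2 * C1_const d L'"
    by (simp add: algebra_simps)
qed

end

section \<open>Rate of the scalar recursion and the final bound\<close>

lemma open_loop_rate:
  fixes \<gamma> :: "nat \<Rightarrow> real"
  assumes step: "\<And>k. \<gamma> (Suc k) \<le> (1 - 2 / (real k + 2)) * \<gamma> k + (2 / (real k + 2))\<^sup>2 / 2 * C"
    and "C \<ge> 0" and "K \<ge> 1"
  shows "\<gamma> K \<le> 2 * C / (real K + 2)"
  using \<open>K \<ge> 1\<close>
proof (induction K rule: dec_induct)
  case base
  \<comment> \<open>At \<open>k = 0\<close> the weight is 1, so the initial gap drops out and the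
    first gap is at most \<open>C / 2\<close>, below the required \<open>2 * C / 3\<close>.\<close>
  then show ?case using step[of 0] \<open>C \<ge> 0\<close> by simp
next
  case (step k)
  define r where "r = real k + 2"
  then have r: "r > 2" using step.hyps by simp
  have "\<gamma> (Suc k) \<le> (1 - 2 / r) * \<gamma> k + (2 / r)\<^sup>2 / 2 * C"
    unfolding r_def by (rule assms(1))
  also have "\<dots> \<le> (1 - 2 / r) * (2 * C / r) + (2 / r)\<^sup>2 / 2 * C"
    \<comment> \<open>Since \<open>r > 2\<close>, the coefficient \<open>1 - 2 / r\<close> is
      nonnegative and the induction hypothesis can be inserted.\<close>
    using step.IH r by (intro add_right_mono mult_left_mono) (auto simp: r_def)
  also have "\<dots> = 2 * C * ((r - 1) / r\<^sup>2)"
    using r by (simp add: field_simps power2_eq_square)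
  \<comment> \<open>This is \<open>(r - 1) * (r + 1) \<le> r\<^sup>2\<close>; the new denominator
    \<open>r + 1\<close> is \<open>real (Suc k) + 2\<close>.\<close>
  also have "\<dots> \<le> 2 * C * (1 / (r + 1))"
    using \<open>C \<ge> 0\<close> r by (intro mult_left_mono) (auto simp: divide_simps power2_eq_square algebra_simps)
  finally show ?case by (simp add: r_def algebra_simps)
qed

theorem proposition3p4:
  fixes X :: "'n::finite \<Rightarrow> 'x set"
    and E :: "'m::finite \<Rightarrow> 'e::{real_inner,banach,second_countable_topology} set"
    and g :: "'n \<Rightarrow> 'm \<Rightarrow> 'x \<Rightarrow> 'e"
    and f :: "'m \<Rightarrow> 'e \<Rightarrow> real"
    and d :: "'n \<Rightarrow> 'm \<Rightarrow> real"
    and L L' :: "'m \<Rightarrow> real"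
    and \<SS> :: "'n \<Rightarrow> 'e^'m \<Rightarrow> 'x"
    and \<mu> :: "nat \<Rightarrow> 'n \<Rightarrow> 'x pmf"
    and K :: nat
  assumes "\<And>i. X i \<noteq> {}"
    and "\<And>j. subspace (E j)" and "\<And>j. closed (E j)"
    and "\<And>i j. g i j \<in> X i \<rightarrow> E j"
    and "assumption1 X E g f d L L'"
    and "assumption2 X g f"
    and "assumption3 X E g f \<SS>"
    and "C1_const d L' > 0"
    and "frank_wolfe X E g f \<SS> \<mu>"
    and "K \<ge> 1"
  shows "Jfun f g (\<mu> K) - Jstar X f g \<le> 2 * C1_const d L' / real K"
proof -
  interpret frank_wolfe_setting X E g f d L L' \<SS>
    using assms by unfold_locales
  have mix: "pmf (\<mu> (Suc k) i) x = (1 - 2 / (real k + 2)) * pmf (\<mu> k i) x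
      + 2 / (real k + 2) * pmf (return_pmf (\<SS> i (grad (ymean g (\<mu> k))))) x" for k i x
    using assms(9) unfolding frank_wolfe_def Let_def by blast
  have w: "0 \<le> 2 / (real k + 2)" "2 / (real k + 2) \<le> 1" for k by auto
  have P: "\<mu> k \<in> Pdelta X" for k
  proof (induction k)
    case 0
    then show ?case using assms(9) by (simp add: frank_wolfe_def)
  next
    case (Suc k)
    then show ?case using w mix by (rule frank_wolfe_gap_step(1))
  qed
  have "Jfun f g (\<mu> K) - Jstar X f g \<le> 2 * C1_const d L' / (real K + 2)"
    using P w mix assms(8,10)
    by (intro open_loop_rate[where \<gamma> = "\<lambda>k. Jfun f g (\<mu> k) - Jstar X f g"] frank_wolfe_gap_step(2)) auto
  also have "\<dots> \<le> 2 * C1_const d L' / real K"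
    using assms(8,10) by (intro divide_left_mono) auto
  finally show ?thesis .
qed

end
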